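(* Let $G$ be a nontrivial additive subgroup of $\mathbb C$. There are no nontrivial transposed Poisson structures defined on the Lie algebra $\widetilde W(G)$; that is, every commutative associative bilinear multiplication $\cdot$ on $\widetilde W(G)$ satisfying $2z\cdot[x,y]=[z\cdot x,y]+[x,z\cdot y]$ for all $x,y,z\in\widetilde W(G)$ is identically zero.
   Context: All vector spaces are over $\mathbb C$. A transposed Poisson structure on a Lie algebra $(\mathfrak L,[\cdot,\cdot])$ is a commutative associative bilinear multiplication $\cdot$ on $\mathfrak L$ with $2z\cdot[x,y]=[z\cdot x,y]+[x,z\cdot y]$ for all $x,y,z\in\mathfrak L$; it is trivial if $\cdot$ is identically zero. $\widetilde W(G)$ is the Lie algebra with basis $\{L_{\alpha,i}\mid\alpha\in G,\ i\in\mathbb Z\}\cup\{C\}$, with $C$ central and $$[L_{\alpha,i},L_{\beta,j}]=(\beta-\alpha)L_{\alpha+\beta,i+j}+(j-i)L_{\alpha+\beta,i+j-1}+\delta_{\alpha,-\beta}\big(\delta_{i+j,-1}\alpha^3+3i\,\delta_{i+j,0}\alpha^2+3i(i-1)\delta_{i+j,1}\alpha+i(i-1)(i-2)\delta_{i+j,2}\big)C.$$ *)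

theory Defs
  imports Complex_Main "HOL-Library.Poly_Mapping"
begin

section \<open>Lie algebras and transposed Poisson structures\<close>

text \<open>Vector spaces are subspaces of an ambient complex vector space given by a scalar
  multiplication in the sense of \<^locale>\<open>vector_space\<close>; operations are only constrained on the
  subspace.\<close>

definition bilinear_op_on :: "(complex \<Rightarrow> 'v \<Rightarrow> 'v) \<Rightarrow> 'v set \<Rightarrow> ('v \<Rightarrow> 'v \<Rightarrow> 'v::ab_group_add) \<Rightarrow> bool"
  where "bilinear_op_on scale V f \<longleftrightarrow>
    (\<forall>x\<in>V. \<forall>y\<in>V. f x y \<in> V) \<and>
    (\<forall>x\<in>V. \<forall>y\<in>V. \<forall>z\<in>V. f (x + y) z = f x z + f y z) \<and>
    (\<forall>x\<in>V. \<forall>y\<in>V. \<forall>z\<in>V. f x (y + z) = f x y + f x z) \<and>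
    (\<forall>c. \<forall>x\<in>V. \<forall>y\<in>V. f (scale c x) y = scale c (f x y)) \<and>
    (\<forall>c. \<forall>x\<in>V. \<forall>y\<in>V. f x (scale c y) = scale c (f x y))"

locale lie_algebra = vector_space scale
  for scale :: "complex \<Rightarrow> 'v::ab_group_add \<Rightarrow> 'v" +
  fixes V :: "'v set" and br :: "'v \<Rightarrow> 'v \<Rightarrow> 'v"
  assumes subspace_carrier: "subspace V"
    and bilinear_br: "bilinear_op_on scale V br"
    and br_self: "x \<in> V \<Longrightarrow> br x x = 0"
    and jacobi: "x \<in> V \<Longrightarrow> y \<in> V \<Longrightarrow> z \<in> V \<Longrightarrow>
      br x (br y z) + br y (br z x) + br z (br x y) = 0"

locale transposed_poisson = lie_algebra scale V br
  for scale :: "complex \<Rightarrow> 'v::ab_group_add \<Rightarrow> 'v" and V br +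
  fixes mul :: "'v \<Rightarrow> 'v \<Rightarrow> 'v"
  assumes bilinear_mul: "bilinear_op_on scale V mul"
    and mul_commute: "x \<in> V \<Longrightarrow> y \<in> V \<Longrightarrow> mul x y = mul y x"
    and mul_assoc: "x \<in> V \<Longrightarrow> y \<in> V \<Longrightarrow> z \<in> V \<Longrightarrow> mul (mul x y) z = mul x (mul y z)"
    and transposed_leibniz: "x \<in> V \<Longrightarrow> y \<in> V \<Longrightarrow> z \<in> V \<Longrightarrow>
      scale 2 (mul z (br x y)) = br (mul z x) y + br x (mul z y)"

section \<open>The free complex vector space on a set\<close>

definition cscale :: "complex \<Rightarrow> ('b \<Rightarrow>\<^sub>0 complex) \<Rightarrow> ('b \<Rightarrow>\<^sub>0 complex)"
  where "cscale c x = Poly_Mapping.map (\<lambda>t. c * t) x"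

definition bvec :: "'b \<Rightarrow> ('b \<Rightarrow>\<^sub>0 complex)"
  where "bvec b = Poly_Mapping.single b 1"

definition bilinear_ext ::
    "('b \<Rightarrow> 'b \<Rightarrow> ('c \<Rightarrow>\<^sub>0 complex)) \<Rightarrow> ('b \<Rightarrow>\<^sub>0 complex) \<Rightarrow> ('b \<Rightarrow>\<^sub>0 complex) \<Rightarrow> ('c \<Rightarrow>\<^sub>0 complex)"
  where "bilinear_ext g x y =
    (\<Sum>a\<in>Poly_Mapping.keys x. \<Sum>b\<in>Poly_Mapping.keys y.
      cscale (Poly_Mapping.lookup x a * Poly_Mapping.lookup y b) (g a b))"

section \<open>The Lie algebra\<close>

definition additive_subgroup_of_complex :: "complex set \<Rightarrow> bool"
  where "additive_subgroup_of_complex G \<longleftrightarrow>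
    0 \<in> G \<and> (\<forall>a\<in>G. \<forall>b\<in>G. a + b \<in> G) \<and> (\<forall>a\<in>G. - a \<in> G)"

text \<open>The indices \<open>Lx \<alpha> i\<close> and \<open>Cx\<close> name the basis vectors \<open>L\<^sub>\<alpha>\<^sub>,\<^sub>i\<close> and \<open>C\<close>.  Indices with \<open>\<alpha>\<close> outside
  \<open>G\<close> are excluded by the carrier \<open>Wt G\<close>.\<close>

datatype wt_index = Lx complex int | Cx

definition Wt :: "complex set \<Rightarrow> (wt_index \<Rightarrow>\<^sub>0 complex) set"
  where "Wt G = {x. Poly_Mapping.keys x \<subseteq> {Lx \<alpha> i |\<alpha> i. \<alpha> \<in> G} \<union> {Cx}}"

definition wt_cocycle :: "complex \<Rightarrow> int \<Rightarrow> complex \<Rightarrow> int \<Rightarrow> complex"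
  where "wt_cocycle \<alpha> i \<beta> j = of_bool (\<alpha> = - \<beta>) *
    (of_bool (i + j = -1) * \<alpha> ^ 3
     + 3 * of_int i * of_bool (i + j = 0) * \<alpha> ^ 2
     + 3 * of_int (i * (i - 1)) * of_bool (i + j = 1) * \<alpha>
     + of_int (i * (i - 1) * (i - 2)) * of_bool (i + j = 2))"

fun wt_br_basis :: "wt_index \<Rightarrow> wt_index \<Rightarrow> (wt_index \<Rightarrow>\<^sub>0 complex)"
  where
    "wt_br_basis (Lx \<alpha> i) (Lx \<beta> j) =
       cscale (\<beta> - \<alpha>) (bvec (Lx (\<alpha> + \<beta>) (i + j)))
       + cscale (of_int (j - i)) (bvec (Lx (\<alpha> + \<beta>) (i + j - 1)))
       + cscale (wt_cocycle \<alpha> i \<beta> j) (bvec Cx)"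
  | "wt_br_basis Cx _ = 0"
  | "wt_br_basis _ Cx = 0"

definition wt_br :: "(wt_index \<Rightarrow>\<^sub>0 complex) \<Rightarrow> (wt_index \<Rightarrow>\<^sub>0 complex) \<Rightarrow> (wt_index \<Rightarrow>\<^sub>0 complex)"
  where "wt_br = bilinear_ext wt_br_basis"

section \<open>\<open>Wt G\<close> is a Lie algebra\<close>

lemma lookup_cscale [simp]: "Poly_Mapping.lookup (cscale c x) k = c * Poly_Mapping.lookup x k"
  by (auto simp: cscale_def Poly_Mapping.map.rep_eq when_def)

lemma vector_space_cscale: "vector_space cscale"
  by unfold_locales (auto intro!: poly_mapping_eqI simp: lookup_add algebra_simps)

interpretation cs: vector_space cscale
  by (rule vector_space_cscale)

lemma bilinear_ext_superset:
  assumes "finite A" "Poly_Mapping.keys x \<subseteq> A" "finite B" "Poly_Mapping.keys y \<subseteq> B"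
  shows "bilinear_ext g x y =
    (\<Sum>a\<in>A. \<Sum>b\<in>B. cscale (Poly_Mapping.lookup x a * Poly_Mapping.lookup y b) (g a b))"
proof -
  have "bilinear_ext g x y = (\<Sum>a\<in>Poly_Mapping.keys x. \<Sum>b\<in>B.
      cscale (Poly_Mapping.lookup x a * Poly_Mapping.lookup y b) (g a b))"
    unfolding bilinear_ext_def
    by (intro sum.cong refl sum.mono_neutral_left) (use assms in \<open>auto simp: in_keys_iff\<close>)
  also have "\<dots> = (\<Sum>a\<in>A. \<Sum>b\<in>B. cscale (Poly_Mapping.lookup x a * Poly_Mapping.lookup y b) (g a b))"
    by (intro sum.mono_neutral_left) (use assms in \<open>auto simp: in_keys_iff\<close>)
  finally show ?thesis .
qed

lemma bilinear_ext_add_left: "bilinear_ext g (x + y) z = bilinear_ext g x z + bilinear_ext g y z"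
proof -
  let ?A = "Poly_Mapping.keys x \<union> Poly_Mapping.keys y"
  have "Poly_Mapping.keys (x + y) \<subseteq> ?A" by (rule keys_add)
  then show ?thesis
    by (simp add: bilinear_ext_superset[of ?A _ "Poly_Mapping.keys z"] lookup_add
        distrib_right cs.scale_left_distrib sum.distrib)
qed

lemma bilinear_ext_add_right: "bilinear_ext g z (x + y) = bilinear_ext g z x + bilinear_ext g z y"
proof -
  let ?A = "Poly_Mapping.keys x \<union> Poly_Mapping.keys y"
  have "Poly_Mapping.keys (x + y) \<subseteq> ?A" by (rule keys_add)
  then show ?thesis
    by (simp add: bilinear_ext_superset[of "Poly_Mapping.keys z" _ ?A] lookup_add
        distrib_left cs.scale_left_distrib sum.distrib)
qed

lemma keys_cscale: "Poly_Mapping.keys (cscale c x) \<subseteq> Poly_Mapping.keys x"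
  by (auto simp: in_keys_iff)

lemma bilinear_ext_scale_left: "bilinear_ext g (cscale c x) z = cscale c (bilinear_ext g x z)"
  by (simp add: bilinear_ext_superset[of "Poly_Mapping.keys x" _ "Poly_Mapping.keys z"] keys_cscale
      cs.scale_sum_right mult.assoc)

lemma bilinear_ext_scale_right: "bilinear_ext g z (cscale c x) = cscale c (bilinear_ext g z x)"
  by (simp add: bilinear_ext_superset[of "Poly_Mapping.keys z" _ "Poly_Mapping.keys x"] keys_cscale
      cs.scale_sum_right mult.left_commute)

lemma bilinear_ext_bvec: "bilinear_ext g (bvec a) (bvec b) = g a b"
  by (simp add: bilinear_ext_def bvec_def)

lemma bilinear_ext_zero [simp]: "bilinear_ext g 0 y = 0" "bilinear_ext g x 0 = 0"
  by (simp_all add: bilinear_ext_def)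

lemmas wt_br_simps = bilinear_ext_add_left[of wt_br_basis, folded wt_br_def]
  bilinear_ext_add_right[of wt_br_basis, folded wt_br_def]
  bilinear_ext_scale_left[of wt_br_basis, folded wt_br_def]
  bilinear_ext_scale_right[of wt_br_basis, folded wt_br_def]
  bilinear_ext_bvec[of wt_br_basis, folded wt_br_def]
  bilinear_ext_zero[of wt_br_basis, folded wt_br_def]

lemma bvec_expansion:
  "x = (\<Sum>a\<in>Poly_Mapping.keys x. cscale (Poly_Mapping.lookup x a) (bvec a))"
proof (rule poly_mapping_eqI)
  fix k
  have "(\<Sum>a\<in>Poly_Mapping.keys x. Poly_Mapping.lookup x a * Poly_Mapping.lookup (bvec a) k)
      = (\<Sum>a\<in>Poly_Mapping.keys x. if a = k then Poly_Mapping.lookup x a else 0)"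
    by (intro sum.cong) (auto simp: bvec_def lookup_single)
  then show "Poly_Mapping.lookup x k = Poly_Mapping.lookup
      (\<Sum>a\<in>Poly_Mapping.keys x. cscale (Poly_Mapping.lookup x a) (bvec a)) k"
    by (simp add: lookup_sum in_keys_iff)
qed

lemma free_induct [case_names zero add scale basis]:
  assumes "P 0" "\<And>x y. P x \<Longrightarrow> P y \<Longrightarrow> P (x + y)" "\<And>c x. P x \<Longrightarrow> P (cscale c x)"
    and "\<And>a. P (bvec a)"
  shows "P x"
proof -
  have "P (\<Sum>a\<in>A. cscale (Poly_Mapping.lookup x a) (bvec a))" if "finite A" for A
    using that by induction (auto intro: assms)
  from this[of "Poly_Mapping.keys x"] show ?thesis
    using bvec_expansion[of x] by simp
qed

lemma wt_cocycle_eq: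
  assumes "\<alpha> + \<beta> = 0" "i + j = m"
  shows "wt_cocycle \<alpha> i \<beta> j =
    of_bool (m = -1) * \<alpha> ^ 3 + 3 * of_int i * of_bool (m = 0) * \<alpha> ^ 2
    + 3 * (of_int i * (of_int i - 1)) * of_bool (m = 1) * \<alpha>
    + (of_int i * (of_int i - 1) * (of_int i - 2)) * of_bool (m = 2)"
  using assms by (simp add: wt_cocycle_def eq_neg_iff_add_eq_0)

lemma wt_cocycle_antisym: "wt_cocycle \<beta> j \<alpha> i = - wt_cocycle \<alpha> i \<beta> j"
proof (cases "\<alpha> + \<beta> = 0")
  case True
  define m where "m = i + j"
  have b: "\<beta> = - \<alpha>" and j: "(of_int j :: complex) = of_int m - of_int i"
    using True by (auto simp: m_def eq_neg_iff_add_eq_0 add.commute)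
  have 1: "wt_cocycle \<alpha> i \<beta> j =
    of_bool (m = -1) * \<alpha> ^ 3 + 3 * of_int i * of_bool (m = 0) * \<alpha> ^ 2
    + 3 * (of_int i * (of_int i - 1)) * of_bool (m = 1) * \<alpha>
    + (of_int i * (of_int i - 1) * (of_int i - 2)) * of_bool (m = 2)"
    using True by (intro wt_cocycle_eq) (auto simp: m_def)
  have 2: "wt_cocycle \<beta> j \<alpha> i =
    of_bool (m = -1) * \<beta> ^ 3 + 3 * of_int j * of_bool (m = 0) * \<beta> ^ 2
    + 3 * (of_int j * (of_int j - 1)) * of_bool (m = 1) * \<beta>
    + (of_int j * (of_int j - 1) * (of_int j - 2)) * of_bool (m = 2)"
    using True by (intro wt_cocycle_eq) (auto simp: m_def add.commute)
  consider "m = -1" | "m = 0" | "m = 1" | "m = 2" | "m \<notin> {-1, 0, 1, 2}" by blast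
  then show ?thesis
    unfolding 1 2 unfolding b j
    by cases (simp_all add: algebra_simps)
next
  case False
  then show ?thesis
    by (simp add: wt_cocycle_def eq_neg_iff_add_eq_0 add.commute)
qed

lemma wt_br_basis_antisym: "wt_br_basis b a = - wt_br_basis a b"
proof (cases a; cases b)
  fix \<alpha> i \<beta> j
  assume *: "a = Lx \<alpha> i" "b = Lx \<beta> j"
  have "cscale (\<alpha> - \<beta>) v = - cscale (\<beta> - \<alpha>) v"
    "cscale (of_int (i - j)) v = - cscale (of_int (j - i)) v" for v :: "wt_index \<Rightarrow>\<^sub>0 complex"
    by (simp_all flip: cs.scale_minus_left)
  then show ?thesis
    by (simp add: * wt_cocycle_antisym[of \<beta> j] add.commute)
qed auto

lemma wt_br_antisym: "wt_br y x = - wt_br x y"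
proof (induction x rule: free_induct)
  case (basis a)
  show ?case
    by (induction y rule: free_induct) (auto simp: wt_br_simps wt_br_basis_antisym[of a])
qed (auto simp: wt_br_simps)

lemma wt_br_self: "wt_br x x = 0"
proof -
  have "wt_br x x = - wt_br x x" by (rule wt_br_antisym)
  then have "cscale 2 (wt_br x x) = 0"
    by (metis add.right_inverse cs.scale_left_distrib cs.scale_one one_add_one)
  then show ?thesis by simp
qed

lemma wt_br_basis_nested:
  "wt_br (bvec (Lx \<alpha> i)) (wt_br_basis (Lx \<beta> j) (Lx \<gamma> k)) =
     cscale ((\<gamma> - \<beta>) * (\<beta> + \<gamma> - \<alpha>)) (bvec (Lx (\<alpha> + \<beta> + \<gamma>) (i + j + k)))
   + cscale ((\<gamma> - \<beta>) * of_int (j + k - i) + of_int (k - j) * (\<beta> + \<gamma> - \<alpha>))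
       (bvec (Lx (\<alpha> + \<beta> + \<gamma>) (i + j + k - 1)))
   + cscale (of_int (k - j) * of_int (j + k - 1 - i)) (bvec (Lx (\<alpha> + \<beta> + \<gamma>) (i + j + k - 2)))
   + cscale ((\<gamma> - \<beta>) * wt_cocycle \<alpha> i (\<beta> + \<gamma>) (j + k)
       + of_int (k - j) * wt_cocycle \<alpha> i (\<beta> + \<gamma>) (j + k - 1)) (bvec Cx)"
proof -
  have "i + (j + k - 1) = i + j + k - 1" "i + j + k - 1 - 1 = i + j + k - 2" by auto
  then show ?thesis
    by (simp add: wt_br_simps cs.scale_right_distrib cs.scale_left_distrib add.assoc[symmetric]
        del: of_int_diff of_int_add) (simp add: algebra_simps)
qed

lemma wt_cocycle_jacobi:
  fixes \<alpha> \<beta> \<gamma> :: complex and i j k :: int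
  defines "t \<equiv> \<lambda>\<alpha> i \<beta> j \<gamma> k. (\<gamma> - \<beta>) * wt_cocycle \<alpha> i (\<beta> + \<gamma>) (j + k)
       + of_int (k - j) * wt_cocycle \<alpha> i (\<beta> + \<gamma>) (j + k - 1)"
  shows "t \<alpha> i \<beta> j \<gamma> k + t \<beta> j \<gamma> k \<alpha> i + t \<gamma> k \<alpha> i \<beta> j = 0"
proof (cases "\<alpha> + \<beta> + \<gamma> = 0")
  case True
  define n where "n = i + j + k"
  define c :: "int \<Rightarrow> complex \<Rightarrow> complex \<Rightarrow> complex" where "c = (\<lambda>m \<alpha> x.
    of_bool (m = -1) * \<alpha> ^ 3 + 3 * x * of_bool (m = 0) * \<alpha> ^ 2
    + 3 * (x * (x - 1)) * of_bool (m = 1) * \<alpha> + (x * (x - 1) * (x - 2)) * of_bool (m = 2))"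
  have c: "wt_cocycle \<alpha> i \<beta> j = c m \<alpha> (of_int i)" if "\<alpha> + \<beta> = 0" "i + j = m"
    for \<alpha> \<beta> i j m
    using wt_cocycle_eq[OF that] by (simp add: c_def)
  have t: "t \<alpha> i \<beta> j \<gamma> k = (\<gamma> - \<beta>) * c n \<alpha> (of_int i) + (of_int k - of_int j) * c (n - 1) \<alpha> (of_int i)"
    if "\<alpha> + \<beta> + \<gamma> = 0" "i + j + k = n" for \<alpha> \<beta> \<gamma> i j k
  proof -
    have "wt_cocycle \<alpha> i (\<beta> + \<gamma>) (j + k) = c n \<alpha> (of_int i)"
      "wt_cocycle \<alpha> i (\<beta> + \<gamma>) (j + k - 1) = c (n - 1) \<alpha> (of_int i)"
      by (rule c; use that in \<open>simp add: algebra_simps\<close>)+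
    then show ?thesis by (simp add: t_def)
  qed
  have g: "\<gamma> = - \<alpha> - \<beta>"
    using True by (simp add: algebra_simps eq_neg_iff_add_eq_0)
  have k: "(of_int k :: complex) = of_int n - of_int i - of_int j"
    by (simp add: n_def)
  have "t \<alpha> i \<beta> j \<gamma> k + t \<beta> j \<gamma> k \<alpha> i + t \<gamma> k \<alpha> i \<beta> j =
     ((\<gamma> - \<beta>) * c n \<alpha> (of_int i) + (of_int k - of_int j) * c (n - 1) \<alpha> (of_int i))
   + ((\<alpha> - \<gamma>) * c n \<beta> (of_int j) + (of_int i - of_int k) * c (n - 1) \<beta> (of_int j))
   + ((\<beta> - \<alpha>) * c n \<gamma> (of_int k) + (of_int j - of_int i) * c (n - 1) \<gamma> (of_int k))"
    using True by (subst (1 2 3) t) (auto simp: n_def add_ac)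
  also have "\<dots> = 0"
  proof -
    consider "n = -1" | "n = 0" | "n = 1" | "n = 2" | "n = 3" | "n \<notin> {-1, 0, 1, 2, 3}" by blast
    then show ?thesis
      unfolding k g c_def
      by cases (simp_all, (simp_all add: algebra_simps power2_eq_square power3_eq_cube)?)
  qed
  finally show ?thesis .
next
  case False
  then have "\<alpha> + (\<beta> + \<gamma>) \<noteq> 0" "\<beta> + (\<gamma> + \<alpha>) \<noteq> 0" "\<gamma> + (\<alpha> + \<beta>) \<noteq> 0"
    by (simp_all add: add_ac)
  then have "wt_cocycle \<alpha> i (\<beta> + \<gamma>) m = 0" "wt_cocycle \<beta> i (\<gamma> + \<alpha>) m = 0"
    "wt_cocycle \<gamma> i (\<alpha> + \<beta>) m = 0" for i m
    by (simp_all only: wt_cocycle_def eq_neg_iff_add_eq_0) auto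
  then show ?thesis by (simp add: t_def)
qed

lemma wt_jacobi_basis:
  "wt_br (bvec a) (wt_br_basis b c) + wt_br (bvec b) (wt_br_basis c a)
    + wt_br (bvec c) (wt_br_basis a b) = 0"
proof -
  have C: "wt_br (bvec Cx) x = 0" for x
    by (induction x rule: free_induct) (auto simp: wt_br_simps)
  show ?thesis
  proof (cases a; cases b; cases c)
    fix \<alpha> i \<beta> j \<gamma> k
    assume *: "a = Lx \<alpha> i" "b = Lx \<beta> j" "c = Lx \<gamma> k"
    have comb: "(cscale a1 u + cscale a2 v + cscale a3 w + cscale a4 z)
       + (cscale b1 u + cscale b2 v + cscale b3 w + cscale b4 z)
       + (cscale c1 u + cscale c2 v + cscale c3 w + cscale c4 z) = 0"
      if "a1 + b1 + c1 = 0" "a2 + b2 + c2 = 0" "a3 + b3 + c3 = 0" "a4 + b4 + c4 = 0"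
      for a1 a2 a3 a4 b1 b2 b3 b4 c1 c2 c3 c4 and u v w z :: "wt_index \<Rightarrow>\<^sub>0 complex"
    proof -
      have "(cscale a1 u + cscale a2 v + cscale a3 w + cscale a4 z)
       + (cscale b1 u + cscale b2 v + cscale b3 w + cscale b4 z)
       + (cscale c1 u + cscale c2 v + cscale c3 w + cscale c4 z)
       = cscale (a1 + b1 + c1) u + cscale (a2 + b2 + c2) v + cscale (a3 + b3 + c3) w
         + cscale (a4 + b4 + c4) z"
        by (simp add: cs.scale_left_distrib add_ac)
      then show ?thesis by (simp add: that)
    qed
    have s: "\<beta> + \<gamma> + \<alpha> = \<alpha> + \<beta> + \<gamma>" "\<gamma> + \<alpha> + \<beta> = \<alpha> + \<beta> + \<gamma>"
      "j + k + i = i + j + k" "k + i + j = i + j + k"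
      by auto
    show ?thesis
      unfolding * wt_br_basis_nested s
    proof (rule comb)
      show "((\<gamma> - \<beta>) * wt_cocycle \<alpha> i (\<beta> + \<gamma>) (j + k)
           + of_int (k - j) * wt_cocycle \<alpha> i (\<beta> + \<gamma>) (j + k - 1))
         + ((\<alpha> - \<gamma>) * wt_cocycle \<beta> j (\<gamma> + \<alpha>) (k + i)
           + of_int (i - k) * wt_cocycle \<beta> j (\<gamma> + \<alpha>) (k + i - 1))
         + ((\<beta> - \<alpha>) * wt_cocycle \<gamma> k (\<alpha> + \<beta>) (i + j)
           + of_int (j - i) * wt_cocycle \<gamma> k (\<alpha> + \<beta>) (i + j - 1)) = 0"
        by (rule wt_cocycle_jacobi)
    qed (simp_all add: algebra_simps)
  qed (auto simp: C wt_br_simps)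
qed

lemma wt_jacobi: "wt_br x (wt_br y z) + wt_br y (wt_br z x) + wt_br z (wt_br x y) = 0"
proof -
  have add: "(a + b) + (c + d) + (e + f) = 0" if "a + c + e = 0" "b + d + f = 0"
    for a b c d e f :: "wt_index \<Rightarrow>\<^sub>0 complex"
    using that by (metis (no_types, lifting) add.assoc add.commute add.right_neutral)
  have sc: "cscale r a + cscale r b + cscale r c = 0" if "a + b + c = 0"
    for r and a b c :: "wt_index \<Rightarrow>\<^sub>0 complex"
    using that by (metis cs.scale_right_distrib cs.scale_zero_right)
  show ?thesis
  proof (induction x rule: free_induct)
    case (basis a)
    show ?case
    proof (induction y rule: free_induct)
      case (basis b)
      show ?case
        by (induction z rule: free_induct)
          (simp_all add: wt_br_simps wt_jacobi_basis add sc)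
    qed (simp_all add: wt_br_simps add sc)
  qed (simp_all add: wt_br_simps add sc)
qed

lemma subspace_Wt: "cs.subspace (Wt G)"
  unfolding cs.subspace_def Wt_def using keys_add keys_cscale by (fastforce simp del: Un_insert_right)

lemma wt_br_basis_closed:
  assumes "additive_subgroup_of_complex G"
    and "a \<in> {Lx \<alpha> i |\<alpha> i. \<alpha> \<in> G} \<union> {Cx}" "b \<in> {Lx \<alpha> i |\<alpha> i. \<alpha> \<in> G} \<union> {Cx}"
  shows "wt_br_basis a b \<in> Wt G"
proof -
  have "bvec (Lx \<alpha> i) \<in> Wt G" if "\<alpha> \<in> G" for \<alpha> i
    using that by (simp add: Wt_def bvec_def)
  moreover have "bvec Cx \<in> Wt G"
    by (simp add: Wt_def bvec_def)
  moreover have "0 \<in> Wt G"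
    by (simp add: Wt_def)
  ultimately show ?thesis
    using assms
    by (cases a; cases b)
      (auto simp: additive_subgroup_of_complex_def
        intro!: cs.subspace_add[OF subspace_Wt] cs.subspace_scale[OF subspace_Wt])
qed

lemma wt_br_closed:
  assumes "additive_subgroup_of_complex G" "x \<in> Wt G" "y \<in> Wt G"
  shows "wt_br x y \<in> Wt G"
  unfolding wt_br_def bilinear_ext_def
  by (intro cs.subspace_sum[OF subspace_Wt] cs.subspace_scale[OF subspace_Wt]
      wt_br_basis_closed assms) (use assms(2,3) in \<open>auto simp: Wt_def\<close>)

theorem lie_algebra_Wt:
  assumes "additive_subgroup_of_complex G"
  shows "lie_algebra cscale (Wt G) wt_br"
proof unfold_locales
  show "bilinear_op_on cscale (Wt G) wt_br"
    using wt_br_closed[OF assms] by (simp add: bilinear_op_on_def wt_br_simps)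
qed (auto simp: subspace_Wt wt_br_self wt_jacobi)

end

theory Submission
  imports Defs
begin

text \<open>Identify \<open>L\<^sub>\<alpha>\<^sub>,\<^sub>i\<close> with the vector field \<open>e\<^sup>\<alpha>\<^sup>t t\<^sup>i d/dt\<close>, so that modulo \<open>C\<close> the bracket is
  \<open>f g' - f' g\<close> and the \<open>C\<close>-component of the bracket is the residue of \<open>f''' g\<close>.  Multiplication by
  a fixed \<open>z\<close> is a half-derivation \<open>\<phi>\<close>.  Evaluating it on the copy of \<open>sl\<^sub>2\<close> spanned by \<open>1, t, t\<^sup>2\<close>
  shows that there it is multiplication by a function \<open>f\<close>, modulo \<open>C\<close>.  The bracket of \<open>sl\<^sub>2\<close> with
  anything has no \<open>C\<close>-component, so the Jacobi identity yields linear conditions on the residues of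
  \<open>(f x)''' h\<close> with \<open>x\<close> in \<open>sl\<^sub>2\<close>; they force in turn \<open>f''' = 0\<close>, \<open>f'' = 0\<close> and \<open>f' = 0\<close>.  By
  commutativity, \<open>t\<close> times the function of \<open>z = 1\<close> is the function of \<open>z = t\<close>, so both are
  annihilated by \<open>d/dt\<close>, and the first one vanishes.  Hence products within \<open>sl\<^sub>2\<close> are central.

  If \<open>\<phi>\<close> sends \<open>x\<close> and \<open>y\<close> to central elements, then \<open>[[x,y],\<phi> z]\<close> equals both \<open>2 \<phi> [[x,y],z]\<close> and
  \<open>4 \<phi> [[x,y],z]\<close>, so \<open>\<phi>\<close> vanishes on \<open>[[x,y],z]\<close>.  Therefore a half-derivation that is central
  on \<open>sl\<^sub>2\<close> is zero; apply this first to \<open>z\<close> in \<open>sl\<^sub>2\<close> and then, by commutativity, to every \<open>z\<close>.\<close>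

section \<open>Coefficients of brackets\<close>

abbreviation coef :: "(wt_index \<Rightarrow>\<^sub>0 complex) \<Rightarrow> complex \<Rightarrow> int \<Rightarrow> complex"
  where "coef x \<gamma> k \<equiv> Poly_Mapping.lookup x (Lx \<gamma> k)"

abbreviation coefC :: "(wt_index \<Rightarrow>\<^sub>0 complex) \<Rightarrow> complex"
  where "coefC x \<equiv> Poly_Mapping.lookup x Cx"

abbreviation L :: "complex \<Rightarrow> int \<Rightarrow> wt_index \<Rightarrow>\<^sub>0 complex"
  where "L \<alpha> i \<equiv> bvec (Lx \<alpha> i)"

text \<open>\<open>dcoef \<gamma>\<close> is \<open>d/dt\<close> acting on the coefficients of \<open>\<Sum>\<^sub>k a\<^sub>k e\<^sup>\<gamma>\<^sup>t t\<^sup>k\<close>.\<close>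

definition dcoef :: "complex \<Rightarrow> (int \<Rightarrow> complex) \<Rightarrow> int \<Rightarrow> complex"
  where "dcoef \<gamma> a k = \<gamma> * a k + of_int (k + 1) * a (k + 1)"

definition dcoef3 :: "complex \<Rightarrow> (int \<Rightarrow> complex) \<Rightarrow> int \<Rightarrow> complex"
  where "dcoef3 \<gamma> a = dcoef \<gamma> (dcoef \<gamma> (dcoef \<gamma> a))"

lemma dcoef3_rec:
  "dcoef3 \<gamma> a k = \<gamma> * dcoef \<gamma> (dcoef \<gamma> a) k + of_int (k + 1) * dcoef \<gamma> (dcoef \<gamma> a) (k + 1)"
  by (simp add: dcoef3_def dcoef_def[of \<gamma> "dcoef \<gamma> (dcoef \<gamma> a)"])

text \<open>A shift of the index by one is multiplication by \<open>t\<close>, so this is the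
  product rule; \<open>dcoef3_shift\<close> and \<open>dcoef3_shift2\<close> are its third-order
  versions for \<open>t\<close> and \<open>t^2\<close>.\<close>

lemma dcoef_shift: "dcoef \<gamma> (\<lambda>k. a (k - 1)) k = a k + dcoef \<gamma> a (k - 1)"
  by (simp add: dcoef_def algebra_simps)

lemma dcoef3_expand:
  "dcoef3 \<gamma> a k = \<gamma> ^ 3 * a k + 3 * \<gamma>\<^sup>2 * of_int (k + 1) * a (k + 1)
     + 3 * \<gamma> * of_int ((k + 1) * (k + 2)) * a (k + 2)
     + of_int ((k + 1) * (k + 2) * (k + 3)) * a (k + 3)"
  by (simp add: dcoef3_def dcoef_def algebra_simps power2_eq_square power3_eq_cube)

lemma dcoef3_shift:
  "dcoef3 \<gamma> (\<lambda>k. a (k - 1)) k = dcoef3 \<gamma> a (k - 1) + 3 * dcoef \<gamma> (dcoef \<gamma> a) k"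
  by (simp add: dcoef3_expand) (simp add: dcoef_def algebra_simps power2_eq_square power3_eq_cube)

lemma dcoef3_shift2:
  "dcoef3 \<gamma> (\<lambda>k. a (k - 2)) k =
     dcoef3 \<gamma> a (k - 2) + 6 * dcoef \<gamma> (dcoef \<gamma> a) (k - 1) + 6 * dcoef \<gamma> a k"
  by (simp add: dcoef3_expand) (simp add: dcoef_def algebra_simps power2_eq_square power3_eq_cube)

lemma lookup_bvec: "Poly_Mapping.lookup (bvec a) b = of_bool (a = b)"
  by (simp add: bvec_def lookup_single when_def)

lemma L_in_Wt: "\<alpha> \<in> G \<Longrightarrow> L \<alpha> i \<in> Wt G"
  by (simp add: Wt_def bvec_def)

lemma wt_br_minus_right: "wt_br x (- y) = - wt_br x y"
  using wt_br_simps(4)[of x "-1" y] by simp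

lemma wt_br_Lie: "wt_br (wt_br x y) z = wt_br x (wt_br y z) - wt_br y (wt_br x z)"
proof -
  have "wt_br x (wt_br y z) + wt_br y (wt_br z x) + wt_br z (wt_br x y) = 0"
    by (rule wt_jacobi)
  moreover have "wt_br y (wt_br z x) = - wt_br y (wt_br x z)"
    using wt_br_antisym[of z x] by (simp add: wt_br_minus_right)
  moreover have "wt_br z (wt_br x y) = - wt_br (wt_br x y) z"
    by (rule wt_br_antisym)
  ultimately show ?thesis by (simp add: algebra_simps)
qed

text \<open>This is the coefficient of \<open>t^i x' - i t^(i-1) x\<close>.\<close>

lemma coef_br:
  "coef (wt_br (L 0 i) x) \<gamma> k =
     \<gamma> * coef x \<gamma> (k - i) + of_int (k + 1 - 2 * i) * coef x \<gamma> (k - i + 1)"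
proof (induction x rule: free_induct)
  case (basis b)
  show ?case
    by (cases b) (auto simp: wt_br_simps lookup_add lookup_bvec of_bool_def)
next
  case (scale c x)
  then show ?case by (simp add: wt_br_simps distrib_left mult.left_commute)
qed (simp_all add: wt_br_simps lookup_add algebra_simps)

text \<open>The residue of \<open>x'''\<close> times \<open>e^(-\<gamma> t) t^(-1-m)\<close> is the
  coefficient of \<open>e^(\<gamma> t) t^m\<close> in \<open>x'''\<close>; hence the exponent
  \<open>- 1 - m\<close>.\<close>

lemma coefC_br:
  "coefC (wt_br x (L (- \<gamma>) (- 1 - m))) = dcoef3 \<gamma> (coef x \<gamma>) m"
proof (induction x rule: free_induct)
  case (basis b)
  show ?case
  proof (cases b)
    case (Lx \<beta> i)
    consider "\<beta> \<noteq> \<gamma>" | "\<beta> = \<gamma>" "i = m" | "\<beta> = \<gamma>" "i = m + 1" | "\<beta> = \<gamma>" "i = m + 2"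
      | "\<beta> = \<gamma>" "i = m + 3" | "\<beta> = \<gamma>" "i \<notin> {m, m + 1, m + 2, m + 3}" by blast
    then show ?thesis
      by cases (auto simp: Lx wt_br_simps lookup_add lookup_minus lookup_bvec dcoef3_expand
          wt_cocycle_def algebra_simps)
  qed (simp add: wt_br_simps lookup_bvec dcoef3_expand)
qed (simp_all add: wt_br_simps lookup_add dcoef3_expand algebra_simps)

text \<open>The third derivatives of \<open>1\<close>, \<open>t\<close> and \<open>t^2\<close>
  vanish.\<close>

lemma coefC_sl2: "i \<in> {0, 1, 2} \<Longrightarrow> coefC (wt_br (L 0 i) x) = 0"
proof (induction x rule: free_induct)
  case (basis b)
  then show ?case
    by (cases b) (auto simp: wt_br_simps lookup_add lookup_bvec wt_cocycle_def)
qed (simp_all add: wt_br_simps lookup_add)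

lemma coefC_br_sl2:
  assumes "i \<in> {0, 1, 2}"
  shows "coefC (wt_br x (wt_br (L 0 i) (L (- \<gamma>) (- 1 - m)))) =
    - \<gamma> * dcoef3 \<gamma> (coef x \<gamma>) (m - i) - of_int (m + 1 + i) * dcoef3 \<gamma> (coef x \<gamma>) (m - i + 1)"
proof -
  have c: "wt_cocycle 0 i (- \<gamma>) (- 1 - m) = 0"
    using assms by (auto simp: wt_cocycle_def)
  have "i + (- 1 - m) = - 1 - (m - i)" "- 1 - (m - i) - 1 = - 1 - (m - i + 1)"
    "- 1 - m - i = - (m + 1 + i)"
    by simp_all
  then have "wt_br (L 0 i) (L (- \<gamma>) (- 1 - m)) = cscale (- \<gamma>) (L (- \<gamma>) (- 1 - (m - i)))
      + cscale (of_int (- (m + 1 + i))) (L (- \<gamma>) (- 1 - (m - i + 1)))"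
    by (simp only: wt_br_simps wt_br_basis.simps c cs.scale_zero_left add_0_left add_0_right
        diff_zero)
  then show ?thesis
    by (simp only: wt_br_simps lookup_add lookup_cscale coefC_br of_int_minus)
       (simp add: algebra_simps)
qed

lemma sl2_brackets:
  "wt_br (L 0 0) (L 0 1) = L 0 0"
  "wt_br (L 0 0) (L 0 2) = cscale 2 (L 0 1)"
  "wt_br (L 0 1) (L 0 2) = L 0 2"
  by (simp_all add: wt_br_simps wt_cocycle_def)

lemma wt_br_eq_0_if_coef_eq_0:
  assumes "\<And>\<gamma> k. coef x \<gamma> k = 0"
  shows "wt_br x y = 0" "wt_br y x = 0"
proof -
  have "x = cscale (coefC x) (bvec Cx)"
  proof (rule poly_mapping_eqI)
    show "Poly_Mapping.lookup x b = Poly_Mapping.lookup (cscale (coefC x) (bvec Cx)) b" for b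
      using assms by (cases b) (simp_all add: lookup_bvec)
  qed
  moreover have "wt_br (bvec Cx) y = 0"
    by (induction y rule: free_induct) (auto simp: wt_br_simps)
  ultimately show "wt_br x y = 0"
    by (metis wt_br_simps(3) cs.scale_zero_right)
  then show "wt_br y x = 0"
    by (metis wt_br_antisym neg_equal_0_iff_equal)
qed

text \<open>With \<open>p = \<phi> t\<close>, \<open>q = \<phi> t\<^sup>2\<close> and \<open>f = \<phi> 1\<close>, the hypotheses are the half-derivation identities for
  the brackets \<open>[1,t] = 1\<close>, \<open>[1,t\<^sup>2] = 2 t\<close> and \<open>[t,t\<^sup>2] = t\<^sup>2\<close>.\<close>

lemma sl2_multiplier:
  fixes f p q :: "int \<Rightarrow> complex"
  assumes 1: "\<And>k. 2 * f k = - (dcoef \<gamma> f (k - 1) - f k) + dcoef \<gamma> p k"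
    and 2: "\<And>k. 4 * p k = - (dcoef \<gamma> f (k - 2) - 2 * f (k - 1)) + dcoef \<gamma> q k"
    and 3: "\<And>k. 2 * q k = - (dcoef \<gamma> p (k - 2) - 2 * p (k - 1)) + (dcoef \<gamma> q (k - 1) - q k)"
  shows "p k = f (k - 1)" "q k = f (k - 2)"
proof -
  \<comment> \<open>Using \<open>1\<close> and \<open>2\<close> to eliminate the derivatives of
    \<open>p\<close> and \<open>q\<close> from \<open>3\<close>, the derivatives of \<open>f\<close>
    cancel and an algebraic relation remains.\<close>
  have q: "q k = 2 * p (k - 1) - f (k - 2)" for k
  proof -
    have "dcoef \<gamma> p (k - 2) = f (k - 2) + dcoef \<gamma> f (k - 3)"
      using 1[of "k - 2"] by (simp add: algebra_simps)
    moreover have "dcoef \<gamma> q (k - 1) = 4 * p (k - 1) + dcoef \<gamma> f (k - 3) - 2 * f (k - 2)"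
      using 2[of "k - 1"] by (simp add: algebra_simps)
    ultimately have "2 * q k = 2 * (3 * p (k - 1) - f (k - 2)) - f (k - 2) - q k"
      using 3[of k] by simp
    then have "3 * q k = 3 * (2 * p (k - 1) - f (k - 2))"
      by (simp add: algebra_simps)
    then show ?thesis
      by (subst (asm) mult_left_cancel) auto
  qed
  \<comment> \<open>Differentiate the relation \<open>q\<close> and compare with \<open>2\<close>;
    after \<open>1\<close> is used for \<open>p'\<close>, the derivatives of \<open>f\<close> cancel
    again.\<close>
  have p: "p k = f (k - 1)" for k
  proof -
    have "dcoef \<gamma> q k = 2 * p k + 2 * dcoef \<gamma> p (k - 1) - 2 * f (k - 1) - dcoef \<gamma> f (k - 2)"
      unfolding dcoef_def q by (simp add: algebra_simps)
    moreover have "dcoef \<gamma> p (k - 1) = f (k - 1) + dcoef \<gamma> f (k - 2)"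
      using 1[of "k - 1"] by (simp add: algebra_simps)
    ultimately have "2 * p k = 2 * f (k - 1)"
      using 2[of k] by (simp add: algebra_simps)
    then show ?thesis by simp
  qed
  show "p k = f (k - 1)" "q k = f (k - 2)"
    by (simp_all add: p q)
qed

section \<open>Half-derivations\<close>

locale half_derivation =
  fixes G :: "complex set" and \<phi> :: "(wt_index \<Rightarrow>\<^sub>0 complex) \<Rightarrow> (wt_index \<Rightarrow>\<^sub>0 complex)"
  assumes subgroup: "additive_subgroup_of_complex G"
    and closed: "x \<in> Wt G \<Longrightarrow> \<phi> x \<in> Wt G"
    and add: "x \<in> Wt G \<Longrightarrow> y \<in> Wt G \<Longrightarrow> \<phi> (x + y) = \<phi> x + \<phi> y"
    and scale: "x \<in> Wt G \<Longrightarrow> \<phi> (cscale c x) = cscale c (\<phi> x)"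
    and leibniz: "x \<in> Wt G \<Longrightarrow> y \<in> Wt G \<Longrightarrow>
      cscale 2 (\<phi> (wt_br x y)) = wt_br (\<phi> x) y + wt_br x (\<phi> y)"
begin

lemma zero_in: "0 \<in> G" and neg_in: "\<gamma> \<in> G \<Longrightarrow> - \<gamma> \<in> G"
  using subgroup by (auto simp: additive_subgroup_of_complex_def)

lemmas br_in = wt_br_closed[OF subgroup]
lemmas L0_in = L_in_Wt[OF zero_in]

lemma zero: "\<phi> 0 = 0"
  using scale[of 0 0] cs.subspace_0[OF subspace_Wt] by simp

lemma diff: "x \<in> Wt G \<Longrightarrow> y \<in> Wt G \<Longrightarrow> \<phi> (x - y) = \<phi> x - \<phi> y"
  using add[of "x - y" y] cs.subspace_diff[OF subspace_Wt, of x G y] by simp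

lemma minus: "x \<in> Wt G \<Longrightarrow> \<phi> (- x) = - \<phi> x"
  using diff[of 0 x] cs.subspace_0[OF subspace_Wt] zero by simp

section \<open>Action of a half-derivation on \<open>1\<close>, \<open>t\<close>,
  \<open>t^2\<close>\<close>

lemma coefC_br_image:
  assumes "x \<in> Wt G" "h \<in> Wt G" "\<And>w. coefC (wt_br x w) = 0"
  shows "coefC (wt_br (\<phi> x) h) = 2 * coefC (\<phi> (wt_br x h))"
  using arg_cong[OF leibniz[OF assms(1,2)], of coefC] assms(3) by (simp add: lookup_add)

text \<open>Jacobi splits \<open>[[x,y],h]\<close>, and brackets with \<open>[x,y]\<close> have no
  \<open>C\<close>-component either, so \<open>coefC_br_image\<close> applies to all three
  terms.\<close>

lemma coefC_br_image_br:
  assumes x: "x \<in> Wt G" "\<And>w. coefC (wt_br x w) = 0"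
    and y: "y \<in> Wt G" "\<And>w. coefC (wt_br y w) = 0"
    and h: "h \<in> Wt G"
  shows "coefC (wt_br (\<phi> (wt_br x y)) h) =
    coefC (wt_br (\<phi> x) (wt_br y h)) - coefC (wt_br (\<phi> y) (wt_br x h))"
proof -
  have "coefC (wt_br (wt_br x y) w) = 0" for w
    by (simp add: wt_br_Lie lookup_minus x y)
  then have "coefC (wt_br (\<phi> (wt_br x y)) h) = 2 * coefC (\<phi> (wt_br (wt_br x y) h))"
    using x y h by (intro coefC_br_image br_in) auto
  also have "\<dots> = 2 * coefC (\<phi> (wt_br x (wt_br y h))) - 2 * coefC (\<phi> (wt_br y (wt_br x h)))"
    using x y h by (simp add: wt_br_Lie diff br_in lookup_minus)
  also have "2 * coefC (\<phi> (wt_br x (wt_br y h))) = coefC (wt_br (\<phi> x) (wt_br y h))"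
    using x y h by (intro coefC_br_image[symmetric] br_in) auto
  also have "2 * coefC (\<phi> (wt_br y (wt_br x h))) = coefC (wt_br (\<phi> y) (wt_br x h))"
    using x y h by (intro coefC_br_image[symmetric] br_in) auto
  finally show ?thesis .
qed

lemma coef_image_sl2:
  "coef (\<phi> (L 0 1)) \<gamma> k = coef (\<phi> (L 0 0)) \<gamma> (k - 1)"
  "coef (\<phi> (L 0 2)) \<gamma> k = coef (\<phi> (L 0 0)) \<gamma> (k - 2)"
proof -
  have eq: "2 * coef (\<phi> (wt_br (L 0 i) (L 0 j))) \<gamma> k =
      - coef (wt_br (L 0 j) (\<phi> (L 0 i))) \<gamma> k + coef (wt_br (L 0 i) (\<phi> (L 0 j))) \<gamma> k" for i j k
    using arg_cong[OF leibniz[OF L0_in L0_in, of i j], of "\<lambda>x. coef x \<gamma> k"]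
      wt_br_antisym[of "\<phi> (L 0 i)" "L 0 j"]
    by (simp add: lookup_add lookup_minus)
  have D: "coef (wt_br (L 0 0) x) \<gamma> k = dcoef \<gamma> (coef x \<gamma>) k"
    "coef (wt_br (L 0 1) x) \<gamma> k = dcoef \<gamma> (coef x \<gamma>) (k - 1) - coef x \<gamma> k"
    "coef (wt_br (L 0 2) x) \<gamma> k = dcoef \<gamma> (coef x \<gamma>) (k - 2) - 2 * coef x \<gamma> (k - 1)" for x k
    by (simp_all add: coef_br dcoef_def algebra_simps)
  let ?f = "coef (\<phi> (L 0 0)) \<gamma>" and ?p = "coef (\<phi> (L 0 1)) \<gamma>" and ?q = "coef (\<phi> (L 0 2)) \<gamma>"
  have 1: "2 * ?f k = - (dcoef \<gamma> ?f (k - 1) - ?f k) + dcoef \<gamma> ?p k" for k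
    using eq[of 0 1 k] unfolding sl2_brackets D .
  have 2: "4 * ?p k = - (dcoef \<gamma> ?f (k - 2) - 2 * ?f (k - 1)) + dcoef \<gamma> ?q k" for k
    using eq[of 0 2 k] unfolding sl2_brackets D scale[OF L0_in] lookup_cscale by simp
  have 3: "2 * ?q k = - (dcoef \<gamma> ?p (k - 2) - 2 * ?p (k - 1)) + (dcoef \<gamma> ?q (k - 1) - ?q k)" for k
    using eq[of 1 2 k] unfolding sl2_brackets D .
  show "?p k = ?f (k - 1)" "?q k = ?f (k - 2)"
    by (rule sl2_multiplier[OF 1 2 3])+
qed

lemma dcoef_image_L00: "dcoef \<gamma> (coef (\<phi> (L 0 0)) \<gamma>) m = 0"
proof (cases "\<gamma> \<in> G")
  case False
  then have "Lx \<gamma> k \<notin> Poly_Mapping.keys (\<phi> (L 0 0))" for k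
    using closed[OF L0_in[of 0]] by (auto simp: Wt_def)
  then show ?thesis
    by (simp add: dcoef_def in_keys_iff)
next
  case True
  define f where "f = coef (\<phi> (L 0 0)) \<gamma>"
  \<comment> \<open>These elements test the \<open>\<gamma>\<close>-coefficients; they lie in the
    carrier only for \<open>\<gamma> \<in> G\<close>, hence the case split.\<close>
  have h: "L (- \<gamma>) j \<in> Wt G" for j
    using True by (intro L_in_Wt neg_in)
  have p: "coef (\<phi> (L 0 1)) \<gamma> = (\<lambda>k. f (k - 1))" and q: "coef (\<phi> (L 0 2)) \<gamma> = (\<lambda>k. f (k - 2))"
    by (auto simp: f_def coef_image_sl2)
  note E = coefC_br_image_br[OF L0_in coefC_sl2 L0_in coefC_sl2 h]
  \<comment> \<open>The pair \<open>1, t\<close> yields \<open>f''' = 2 f'''\<close>. Once the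
    higher derivatives are gone, the pairs \<open>1, t^2\<close> and \<open>t, t^2\<close> likewise
    equate \<open>f''\<close> and \<open>f'\<close> with their doubles.\<close>
  have d3: "dcoef3 \<gamma> f m = 0" for m
    using E[of 0 1 "- 1 - m"]
    by (simp add: sl2_brackets coefC_br coefC_br_sl2 p dcoef3_shift flip: f_def)
       (simp add: dcoef3_rec algebra_simps)
  have d2: "dcoef \<gamma> (dcoef \<gamma> f) m = 0" for m
  proof -
    let ?d1 = "dcoef \<gamma> f" and ?d2 = "dcoef \<gamma> (dcoef \<gamma> f)"
    have "6 * ?d2 m = of_int (m + 1) * (6 * ?d2 m + 6 * ?d1 (m + 1))
        + \<gamma> * (6 * ?d2 (m - 1) + 6 * ?d1 m)"
      using E[of 0 2 "- 1 - m"]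
      by (simp add: sl2_brackets scale[OF L0_in] wt_br_simps(3) coefC_br coefC_br_sl2 p q
          dcoef3_shift dcoef3_shift2 d3 flip: f_def)
    also have "\<dots> = 6 * (\<gamma> * ?d2 (m - 1) + of_int m * ?d2 m) + 6 * ?d2 m
        + 6 * (\<gamma> * ?d1 m + of_int (m + 1) * ?d1 (m + 1))"
      by (simp add: algebra_simps)
    also have "\<dots> = 6 * dcoef3 \<gamma> f (m - 1) + 12 * ?d2 m"
      by (simp add: dcoef3_rec dcoef_def[of \<gamma> ?d1 m])
    finally show ?thesis by (simp add: d3)
  qed
  have "dcoef \<gamma> f m = 0" for m
  proof -
    let ?d1 = "dcoef \<gamma> f"
    have "6 * ?d1 m = of_int (2 + m) * (6 * ?d1 m) + \<gamma> * (6 * ?d1 (m - 1))"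
      using E[of 1 2 "- 1 - m"]
      by (simp add: sl2_brackets coefC_br coefC_br_sl2 p q dcoef3_shift dcoef3_shift2 d3 d2
          flip: f_def)
    also have "\<dots> = 6 * (\<gamma> * ?d1 (m - 1) + of_int m * ?d1 m) + 12 * ?d1 m"
      by (simp add: algebra_simps)
    also have "\<dots> = 6 * dcoef \<gamma> ?d1 (m - 1) + 12 * ?d1 m"
      by (simp add: dcoef_def[of \<gamma> ?d1 "m - 1"])
    finally show ?thesis by (simp add: d2)
  qed
  then show ?thesis by (simp add: f_def)
qed

section \<open>Vanishing of half-derivations that are central on \<open>1\<close>, \<open>t\<close>,
  \<open>t^2\<close>\<close>

lemma image_br_br_eq_0:
  assumes x: "x \<in> Wt G" "\<And>w. wt_br (\<phi> x) w = 0"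
    and y: "y \<in> Wt G" "\<And>w. wt_br (\<phi> y) w = 0"
    and z: "z \<in> Wt G"
  shows "\<phi> (wt_br (wt_br x y) z) = 0"
proof -
  have lx: "cscale 2 (\<phi> (wt_br x w)) = wt_br x (\<phi> w)" if "w \<in> Wt G" for w
    using leibniz[OF x(1) that] x(2) by simp
  have ly: "cscale 2 (\<phi> (wt_br y w)) = wt_br y (\<phi> w)" if "w \<in> Wt G" for w
    using leibniz[OF y(1) that] y(2) by simp
  have c: "wt_br (\<phi> (wt_br x y)) w = 0" for w
  proof -
    have "wt_br x (\<phi> y) = 0"
      using y(2)[of x] wt_br_antisym[of x "\<phi> y"] by simp
    then show ?thesis
      using lx[OF y(1)] by (simp add: wt_br_simps)
  qed
  \<comment> \<open>Passing \<open>x\<close> and \<open>y\<close> out of \<open>\<phi>\<close> one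
    after the other costs a factor 2 each; passing out \<open>[x,y]\<close>, whose image is central
    by \<open>c\<close>, costs only one.\<close>
  have "cscale 4 (\<phi> (wt_br (wt_br x y) z)) =
      cscale 2 (cscale 2 (\<phi> (wt_br x (wt_br y z)))) - cscale 2 (cscale 2 (\<phi> (wt_br y (wt_br x z))))"
    using x y z by (simp add: wt_br_Lie diff br_in cs.scale_right_diff_distrib)
  also have "\<dots> = wt_br x (wt_br y (\<phi> z)) - wt_br y (wt_br x (\<phi> z))"
    using x y z by (simp only: lx ly br_in flip: wt_br_simps(4))
  also have "\<dots> = wt_br (wt_br x y) (\<phi> z)"
    by (simp add: wt_br_Lie)
  also have "\<dots> = cscale 2 (\<phi> (wt_br (wt_br x y) z))"
    using leibniz[of "wt_br x y" z] x y z c by (simp add: br_in)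
  finally show ?thesis by simp
qed

text \<open>As \<open>1 = [1,t]\<close> and \<open>2 t = [1,t^2]\<close>,
  \<open>image_br_br_eq_0\<close> kills all brackets with \<open>1\<close> and with
  \<open>t\<close>; every \<open>L \<alpha> i\<close> is recovered from these.\<close>

lemma eq_0_if_central_on_sl2:
  assumes central: "\<And>i w. i \<in> {0, 1, 2} \<Longrightarrow> wt_br (\<phi> (L 0 i)) w = 0"
    and "x \<in> Wt G"
  shows "\<phi> x = 0"
proof -
  have 0: "\<phi> (wt_br (L 0 0) z) = 0" if "z \<in> Wt G" for z
    using image_br_br_eq_0[of "L 0 0" "L 0 1" z] that
    by (simp add: L0_in central sl2_brackets)
  have 1: "\<phi> (wt_br (L 0 1) z) = 0" if "z \<in> Wt G" for z
    using image_br_br_eq_0[of "L 0 0" "L 0 2" z] that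
    by (simp add: L0_in central sl2_brackets wt_br_simps(3) scale br_in)
  \<comment> \<open>\<open>[1, t^(i+1)] = (i+1) t^i\<close> misses only \<open>t^(-1)\<close>, which
    comes from \<open>[t, t^(-1)] = -2 t^(-1)\<close>.\<close>
  have L0: "\<phi> (L 0 i) = 0" for i
  proof (cases "i = -1")
    case False
    then show ?thesis
      using 0[OF L0_in, of "i + 1"] by (simp add: wt_br_simps wt_cocycle_def scale L0_in)
         (metis add.commute add_eq_0_iff of_int_0_eq_iff of_int_1 of_int_add)
  next
    case True
    then show ?thesis
      using 1[OF L0_in, of "-1"]
      by (simp add: wt_br_simps wt_cocycle_def scale minus L0_in cs.subspace_scale[OF subspace_Wt])
  qed
  have L: "\<phi> (L \<alpha> i) = 0" if "\<alpha> \<in> G" for \<alpha> i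
  proof (cases "\<alpha> = 0")
    case False
    have rec0: "cscale \<alpha> (\<phi> (L \<alpha> i)) + cscale (of_int i) (\<phi> (L \<alpha> (i - 1))) = 0" for i
      using 0[OF L_in_Wt[OF that], of i] that False
      by (simp add: wt_br_simps wt_cocycle_def scale add L_in_Wt cs.subspace_scale[OF subspace_Wt])
    have rec1: "cscale \<alpha> (\<phi> (L \<alpha> (i + 1))) + cscale (of_int (i - 1)) (\<phi> (L \<alpha> i)) = 0" for i
      using 1[OF L_in_Wt[OF that], of i] that False
      by (simp add: wt_br_simps wt_cocycle_def scale add L_in_Wt cs.subspace_scale[OF subspace_Wt]
          add.commute[of 1])
    \<comment> \<open>The term at \<open>i + 1\<close> is common to both recurrences, so their
      difference is \<open>2 \<phi> (L \<alpha> i)\<close>.\<close>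
    have "cscale (of_int (i + 1)) (\<phi> (L \<alpha> i)) = cscale (of_int (i - 1)) (\<phi> (L \<alpha> i))"
      using rec0[of "i + 1"] rec1[of i] by (metis add_diff_cancel_right' add_left_cancel)
    then have "cscale (of_int (i + 1) - of_int (i - 1)) (\<phi> (L \<alpha> i)) = 0"
      unfolding cs.scale_left_diff_distrib by simp
    then show ?thesis by simp
  qed (simp add: L0)
  have C: "\<phi> (bvec Cx) = 0"
  proof -
    have C_in: "bvec Cx \<in> Wt G" by (simp add: Wt_def bvec_def)
    \<comment> \<open>Since \<open>(t^3)''' = 6\<close>, this bracket reaches
      \<open>C\<close>.\<close>
    have "wt_br (L 0 3) (L 0 (-1)) = cscale (-4) (L 0 1) + cscale 6 (bvec Cx)"
      by (simp add: wt_br_simps wt_cocycle_def)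
    then have "cscale 6 (\<phi> (bvec Cx)) = \<phi> (wt_br (L 0 3) (L 0 (-1)))"
      by (simp add: diff scale L0_in C_in cs.subspace_scale[OF subspace_Wt] L0)
    also have "cscale 2 \<dots> = 0"
      unfolding leibniz[OF L0_in L0_in] by (simp add: L0 wt_br_simps)
    finally show ?thesis by simp
  qed
  have b: "\<phi> (bvec a) = 0" and b_in: "bvec a \<in> Wt G"
    if "a \<in> {Lx \<alpha> i |\<alpha> i. \<alpha> \<in> G} \<union> {Cx}" for a
    using that by (auto simp: L C) (auto simp: Wt_def bvec_def)
  have "(\<Sum>a\<in>A. cscale (Poly_Mapping.lookup x a) (bvec a)) \<in> Wt G \<and>
      \<phi> (\<Sum>a\<in>A. cscale (Poly_Mapping.lookup x a) (bvec a)) = 0"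
    if "finite A" "A \<subseteq> {Lx \<alpha> i |\<alpha> i. \<alpha> \<in> G} \<union> {Cx}" for A
    using that
  proof (induction rule: finite_induct)
    case empty
    then show ?case by (simp add: zero cs.subspace_0[OF subspace_Wt])
  next
    case (insert a A)
    then have "a \<in> {Lx \<alpha> i |\<alpha> i. \<alpha> \<in> G} \<union> {Cx}" by blast
    with insert b b_in show ?case
      by (simp add: add scale cs.subspace_add[OF subspace_Wt] cs.subspace_scale[OF subspace_Wt])
  qed
  from this[of "Poly_Mapping.keys x"] show ?thesis
    using assms(2) bvec_expansion[of x] by (simp add: Wt_def)
qed

end

section \<open>Triviality\<close>

theorem theorem16:
  fixes G :: "complex set"
    and mul :: "(wt_index \<Rightarrow>\<^sub>0 complex) \<Rightarrow> (wt_index \<Rightarrow>\<^sub>0 complex) \<Rightarrow> (wt_index \<Rightarrow>\<^sub>0 complex)"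
  assumes "additive_subgroup_of_complex G"
    and "G \<noteq> {0}"
    and "transposed_poisson cscale (Wt G) wt_br mul"
  shows "\<forall>x\<in>Wt G. \<forall>y\<in>Wt G. mul x y = 0"
proof -
  interpret transposed_poisson cscale "Wt G" wt_br mul by fact
  have hd: "half_derivation G (mul z)" if "z \<in> Wt G" for z
    using that assms(1) bilinear_mul transposed_leibniz
    by (auto simp: half_derivation_def bilinear_op_on_def)
  have L_in: "L 0 i \<in> Wt G" for i
    using assms(1) by (auto simp: additive_subgroup_of_complex_def intro: L_in_Wt)
  define f where "f z = coef (mul z (L 0 0))" for z
  have f1: "coef (mul z (L 0 1)) \<gamma> k = f z \<gamma> (k - 1)"
    and f2: "coef (mul z (L 0 2)) \<gamma> k = f z \<gamma> (k - 2)"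
    and df: "dcoef \<gamma> (f z \<gamma>) k = 0" if "z \<in> Wt G" for z \<gamma> k
    using half_derivation.coef_image_sl2[OF hd[OF that]]
      half_derivation.dcoef_image_L00[OF hd[OF that]] by (auto simp: f_def)
  have f_L01: "f (L 0 1) \<gamma> = (\<lambda>k. f (L 0 0) \<gamma> (k - 1))" for \<gamma>
    using f1[OF L_in[of 0]] mul_commute[OF L_in[of 0] L_in[of 1]] by (auto simp: f_def)
  \<comment> \<open>In \<open>(t f)' = f + t f'\<close> both derivatives vanish.\<close>
  have f_L00: "f (L 0 0) \<gamma> k = 0" for \<gamma> k
    using df[OF L_in[of 1], of \<gamma> k] df[OF L_in[of 0], of \<gamma> "k - 1"]
    by (simp add: f_L01 dcoef_shift)
  have f_sl2: "f (L 0 i) \<gamma> k = 0" if "i \<in> {0, 1, 2}" for i \<gamma> k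
    using that f_L00 fun_cong[OF f_L01[of \<gamma>], of k] f2[OF L_in[of 0], of \<gamma> k]
      mul_commute[OF L_in[of 0] L_in[of 2]]
    by (auto simp: f_def)
  have "wt_br (mul (L 0 i) (L 0 j)) w = 0" if "i \<in> {0, 1, 2}" "j \<in> {0, 1, 2}" for i j w
    using that f_sl2[OF that(1)] f1[OF L_in[of i]] f2[OF L_in[of i]]
    by (intro wt_br_eq_0_if_coef_eq_0) (auto simp: f_def)
  then have "mul (L 0 i) z = 0" if "i \<in> {0, 1, 2}" "z \<in> Wt G" for i z
    using that half_derivation.eq_0_if_central_on_sl2[OF hd[OF L_in]] by blast
  then have "mul z (L 0 i) = 0" if "i \<in> {0, 1, 2}" "z \<in> Wt G" for i z
    using that mul_commute[OF L_in] by metis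
  then show ?thesis
    using half_derivation.eq_0_if_central_on_sl2[OF hd] by (simp add: wt_br_simps)
qed

end
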